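(* Let $I_1,I_2\ge2$ and let the row and column logit types $l_1,l_2$ both belong to $\{G,C,R\}$. Let $\pi$ and $\tilde\pi$ be two strictly positive probability distributions on $\{1,\dots,I_1\}\times\{1,\dots,I_2\}$, and let $p(i,j;u,v)$, $p_1(i;u)$, $p_2(j;v)$ (respectively $\tilde p(i,j;u,v)$, $\tilde p_1(i;u)$, $\tilde p_2(j;v)$) be the associated joint and marginal event probabilities, $i\in\{1,\dots,I_1-1\}$, $j\in\{1,\dots,I_2-1\}$, $u,v\in\{0,1\}$. Suppose that $$p(i,j;u,v)=p_1(i;u)\,p_2(j;v)\,G\big[\alpha_{iju}+\beta_{ijv}+\upsilon_{ij}(u,v)\big],\qquad \upsilon_{ij}(u,v)=\sum_{k=1}^K\psi_k\,\mu_{k,i+u}\,\nu_{k,j+v},$$ for some real parameters, and that $\tilde p(i,j;u,v)$ has the same form with its own parameters $\tilde\alpha,\tilde\beta,\tilde\psi,\tilde\mu,\tilde\nu$ (and corresponding $\tilde\upsilon$). Let $$\gamma_{ij}=\upsilon_{ij}(0,0)-\upsilon_{ij}(0,1)-\upsilon_{ij}(1,0)+\upsilon_{ij}(1,1)$$ and define $\tilde\gamma_{ij}$ analogously from $\tilde\upsilon$. If $p_1(i;u)=\tilde p_1(i;u)$, $p_2(j;v)=\tilde p_2(j;v)$ and $\gamma_{ij}=\tilde\gamma_{ij}$ for all $i\in\{1,\dots,I_1-1\}$, $j\in\{1,\dots,I_2-1\}$, $u,v\in\{0,1\}$, then $p(i,j;u,v)=\tilde p(i,j;u,v)$ for all such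 $i,j,u,v$. That is, for fixed row and column marginals the interactions $\gamma_{ij}$ determine uniquely the $2\times2$ tables $(p(i,j;u,v))_{u,v}$.
   Context: $(X_1,X_2)$ has joint distribution $\pi=(\pi_{ij})$, with $X_1$ having categories $1,\dots,I_1$ and $X_2$ categories $1,\dots,I_2$. Each variable is assigned a logit type $l\in\{L,G,C,R\}$ (local, global, continuation, reverse continuation). For a variable with $I$ categories and a cut point $x\in\{1,\dots,I-1\}$ define $E(x,0,l)=\{x\}$ if $l\in\{L,C\}$ and $E(x,0,l)=\{1,\dots,x\}$ if $l\in\{G,R\}$; $E(x,1,l)=\{x+1\}$ if $l\in\{L,R\}$ and $E(x,1,l)=\{x+1,\dots,I\}$ if $l\in\{G,C\}$. Then $p(i,j;u,v)=P(X_1\in E(i,u,l_1),X_2\in E(j,v,l_2))$, $p_1(i;u)=P(X_1\in E(i,u,l_1))$, $p_2(j;v)=P(X_2\in E(j,v,l_2))$. $\phi$ is a real-valued convex function on $[0,\infty)$, differentiable on $(0,\infty)$, with $\phi(1)=\phi'(1)=0$; $F=\phi'$ is strictly increasing on $(0,\infty)$ and $G=F^{-1}$ is its (strictly increasing) inverse. *)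

theory Defs
  imports "HOL-Analysis.Analysis" "HOL-Probability.Probability"
begin

datatype logit = Local_logit | Global_logit | Continuation_logit | Reverse_logit

(* Categories of a variable are the numbers 1..n; x is a cut point in 1..n-1.
   The argument u is meant to be 0 or 1. *)
definition logit_event :: "nat \<Rightarrow> logit \<Rightarrow> nat \<Rightarrow> nat \<Rightarrow> nat set" where
  "logit_event n l x u =
    (if u = 0
     then (if l \<in> {Local_logit, Continuation_logit} then {x} else {1..x})
     else (if l \<in> {Local_logit, Reverse_logit} then {x+1} else {x+1..n}))"

definition joint_prob ::
  "nat \<Rightarrow> nat \<Rightarrow> logit \<Rightarrow> logit \<Rightarrow> (nat \<times> nat) pmf \<Rightarrow> nat \<Rightarrow> nat \<Rightarrow> nat \<Rightarrow> nat \<Rightarrow> real" where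
  "joint_prob I1 I2 l1 l2 \<pi> i j u v =
    measure_pmf.prob \<pi> (logit_event I1 l1 i u \<times> logit_event I2 l2 j v)"

definition row_prob :: "nat \<Rightarrow> logit \<Rightarrow> (nat \<times> nat) pmf \<Rightarrow> nat \<Rightarrow> nat \<Rightarrow> real" where
  "row_prob I1 l1 \<pi> i u = measure_pmf.prob (map_pmf fst \<pi>) (logit_event I1 l1 i u)"

definition col_prob :: "nat \<Rightarrow> logit \<Rightarrow> (nat \<times> nat) pmf \<Rightarrow> nat \<Rightarrow> nat \<Rightarrow> real" where
  "col_prob I2 l2 \<pi> j v = measure_pmf.prob (map_pmf snd \<pi>) (logit_event I2 l2 j v)"

definition upsilon ::
  "nat \<Rightarrow> (nat \<Rightarrow> real) \<Rightarrow> (nat \<Rightarrow> nat \<Rightarrow> real) \<Rightarrow> (nat \<Rightarrow> nat \<Rightarrow> real) \<Rightarrow>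
   nat \<Rightarrow> nat \<Rightarrow> nat \<Rightarrow> nat \<Rightarrow> real" where
  "upsilon K \<psi> \<mu> \<nu> i j u v = (\<Sum>k=1..K. \<psi> k * \<mu> k (i + u) * \<nu> k (j + v))"

definition interaction ::
  "nat \<Rightarrow> (nat \<Rightarrow> real) \<Rightarrow> (nat \<Rightarrow> nat \<Rightarrow> real) \<Rightarrow> (nat \<Rightarrow> nat \<Rightarrow> real) \<Rightarrow> nat \<Rightarrow> nat \<Rightarrow> real" where
  "interaction K \<psi> \<mu> \<nu> i j =
    upsilon K \<psi> \<mu> \<nu> i j 0 0 - upsilon K \<psi> \<mu> \<nu> i j 0 1
    - upsilon K \<psi> \<mu> \<nu> i j 1 0 + upsilon K \<psi> \<mu> \<nu> i j 1 1"

(* G is the inverse of F = deriv \<phi> restricted to (0, \<infinity>).  Outside the range of that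
   restriction the value of inv_into is arbitrary, so association_model below also
   requires the argument of G to lie in the range, i.e. in the domain of the inverse. *)
definition deriv_inverse :: "(real \<Rightarrow> real) \<Rightarrow> real \<Rightarrow> real" where
  "deriv_inverse \<phi> = inv_into {0<..} (deriv \<phi>)"

definition association_model ::
  "(real \<Rightarrow> real) \<Rightarrow> nat \<Rightarrow> nat \<Rightarrow> logit \<Rightarrow> logit \<Rightarrow> (nat \<times> nat) pmf \<Rightarrow> nat \<Rightarrow>
   (nat \<Rightarrow> nat \<Rightarrow> nat \<Rightarrow> real) \<Rightarrow> (nat \<Rightarrow> nat \<Rightarrow> nat \<Rightarrow> real) \<Rightarrow>
   (nat \<Rightarrow> real) \<Rightarrow> (nat \<Rightarrow> nat \<Rightarrow> real) \<Rightarrow> (nat \<Rightarrow> nat \<Rightarrow> real) \<Rightarrow> bool" where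
  "association_model \<phi> I1 I2 l1 l2 \<pi> K \<alpha> \<beta> \<psi> \<mu> \<nu> \<longleftrightarrow>
    (\<forall>i\<in>{1..I1-1}. \<forall>j\<in>{1..I2-1}. \<forall>u\<in>{0,1}. \<forall>v\<in>{0,1}.
      \<alpha> i j u + \<beta> i j v + upsilon K \<psi> \<mu> \<nu> i j u v \<in> deriv \<phi> ` {0<..} \<and>
      joint_prob I1 I2 l1 l2 \<pi> i j u v =
        row_prob I1 l1 \<pi> i u * col_prob I2 l2 \<pi> j v *
        deriv_inverse \<phi> (\<alpha> i j u + \<beta> i j v + upsilon K \<psi> \<mu> \<nu> i j u v))"

end

theory Submission
  imports Defs
begin

text \<open>
  Fix the cut points \<open>i\<close>, \<open>j\<close>. If the two \<open>2 \<times> 2\<close> tables have the same margins, their difference is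
  \<open>d, -d, -d, d\<close>. If \<open>d > 0\<close>, monotonicity of \<open>F\<close> makes the alternating sum of the terms
  \<open>F (p / (p\<^sub>1 p\<^sub>2))\<close>, which is the interaction, strictly larger for the first table; so
  \<open>d = 0\<close>. The margins of a table arise from merging the two events of one variable. The merged event is either
  certain, so that the margin is a prescribed one, or (for continuation and reverse
  continuation logits) an event of the neighbouring cut point, so that the margin is an entry of an
  earlier table. Induction along the cut points then gives equality of all tables.
\<close>

lemma table_le:
  fixes r c :: "nat \<Rightarrow> real" and p p' x x' :: "nat \<Rightarrow> nat \<Rightarrow> real"
  assumes F: "strict_mono_on S F"
    and r: "\<And>u. r u \<ge> 0" and c: "\<And>v. c v \<ge> 0"
    and x: "\<And>u v. u \<in> {0,1} \<Longrightarrow> v \<in> {0,1} \<Longrightarrow>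
      x u v \<in> F ` S \<and> p u v = r u * c v * inv_into S F (x u v)"
    and x': "\<And>u v. u \<in> {0,1} \<Longrightarrow> v \<in> {0,1} \<Longrightarrow>
      x' u v \<in> F ` S \<and> p' u v = r u * c v * inv_into S F (x' u v)"
    and rows: "\<And>u. u \<in> {0,1} \<Longrightarrow> p u 0 + p u 1 = p' u 0 + p' u 1"
    and cols: "\<And>v. v \<in> {0,1} \<Longrightarrow> p 0 v + p 1 v = p' 0 v + p' 1 v"
    and inter: "x 0 0 - x 0 1 - x 1 0 + x 1 1 = x' 0 0 - x' 0 1 - x' 1 0 + x' 1 1"
  shows "p 0 0 \<le> p' 0 0"
proof (rule ccontr)
  assume less: "\<not> p 0 0 \<le> p' 0 0"
  \<comment> \<open>A strict inequality between products with the common nonnegative factor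
    \<open>r u * c v\<close> forces one between the inverse values, and \<open>F\<close> carries it
    over to their arguments.\<close>
  have mono: "a < b"
    if "a \<in> F ` S" "b \<in> F ` S" "r u * c v * inv_into S F a < r u * c v * inv_into S F b"
    for a b u v
  proof -
    have "inv_into S F a < inv_into S F b"
      using that(3) r[of u] c[of v] by (meson mult_left_mono mult_nonneg_nonneg not_le)
    with F have "F (inv_into S F a) < F (inv_into S F b)"
      using that(1,2) by (meson inv_into_into strict_mono_onD)
    then show ?thesis
      using that(1,2) by (simp add: f_inv_into_f)
  qed
  have "p' 0 0 < p 0 0" "p 0 1 < p' 0 1" "p 1 0 < p' 1 0" "p' 1 1 < p 1 1"
    using less rows[of 0] rows[of 1] cols[of 0] by auto
  then have "x' 0 0 < x 0 0" "x 0 1 < x' 0 1" "x 1 0 < x' 1 0" "x' 1 1 < x 1 1"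
    using x[of 0 0] x[of 0 1] x[of 1 0] x[of 1 1] x'[of 0 0] x'[of 0 1] x'[of 1 0] x'[of 1 1]
    by (auto intro: mono)
  with inter show False
    by linarith
qed

text \<open>The hypotheses are symmetric in the two tables, so the one-sided bound applies in both
  directions. The margins then carry equality from the cell \<open>0 0\<close> to the other
  three.\<close>

lemma table_unique:
  fixes r c :: "nat \<Rightarrow> real" and p p' x x' :: "nat \<Rightarrow> nat \<Rightarrow> real"
  assumes F: "strict_mono_on S F"
    and r: "\<And>u. r u \<ge> 0" and c: "\<And>v. c v \<ge> 0"
    and x: "\<And>u v. u \<in> {0,1} \<Longrightarrow> v \<in> {0,1} \<Longrightarrow>
      x u v \<in> F ` S \<and> p u v = r u * c v * inv_into S F (x u v)"
    and x': "\<And>u v. u \<in> {0,1} \<Longrightarrow> v \<in> {0,1} \<Longrightarrow>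
      x' u v \<in> F ` S \<and> p' u v = r u * c v * inv_into S F (x' u v)"
    and rows: "\<And>u. u \<in> {0,1} \<Longrightarrow> p u 0 + p u 1 = p' u 0 + p' u 1"
    and cols: "\<And>v. v \<in> {0,1} \<Longrightarrow> p 0 v + p 1 v = p' 0 v + p' 1 v"
    and inter: "x 0 0 - x 0 1 - x 1 0 + x 1 1 = x' 0 0 - x' 0 1 - x' 1 0 + x' 1 1"
    and uv: "u \<in> {0,1}" "v \<in> {0,1}"
  shows "p u v = p' u v"
proof -
  have "p 0 0 \<le> p' 0 0"
    by (rule table_le[OF F r c x x' rows cols inter])
  moreover have "p' 0 0 \<le> p 0 0"
    by (rule table_le[OF F r c x' x rows[symmetric] cols[symmetric] inter[symmetric]])
  ultimately have "p 0 0 = p' 0 0"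
    by simp
  then show ?thesis
    using uv rows[of 0] rows[of 1] cols[of 0] by auto
qed

text \<open>Induction measure: the number of steps to the end of the scale towards which merging
  moves the cut. Continuation events merge to \<open>{x..n}\<close>, the upper event at
  \<open>x - 1\<close>; reverse ones merge to \<open>{1..x+1}\<close>, the lower event at
  \<open>x + 1\<close>.\<close>

fun cut_depth :: "nat \<Rightarrow> logit \<Rightarrow> nat \<Rightarrow> nat" where
  "cut_depth n Continuation_logit x = x"
| "cut_depth n Reverse_logit x = n - x"
| "cut_depth n l x = 0"

lemma logit_event_disjoint: "logit_event n l x 0 \<inter> logit_event n l x 1 = {}"
  by (auto simp: logit_event_def)

text \<open>Local logits are excluded since they merge to \<open>{x, x+1}\<close>, which in general
  is neither the whole scale nor an event of another cut.\<close>

lemma logit_event_merge: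
  assumes l: "l \<in> {Global_logit, Continuation_logit, Reverse_logit}" and x: "x \<in> {1..n-1}"
  obtains "logit_event n l x 0 \<union> logit_event n l x 1 = {1..n}"
  | y w where "y \<in> {1..n-1}" "w \<in> {0,1}"
      "logit_event n l x 0 \<union> logit_event n l x 1 = logit_event n l y w"
      "cut_depth n l y < cut_depth n l x"
proof (cases l)
  case Local_logit
  with l show ?thesis by simp
next
  case Global_logit
  with x have "logit_event n l x 0 \<union> logit_event n l x 1 = {1..n}"
    by (auto simp: logit_event_def)
  then show ?thesis by (rule that(1))
next
  case Continuation_logit
  with x have u: "logit_event n l x 0 \<union> logit_event n l x 1 = {x..n}"
    by (auto simp: logit_event_def)
  show ?thesis
  proof (cases "x = 1")
    case True
    with u show ?thesis by (intro that(1)) simp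
  next
    case False
    with x u Continuation_logit show ?thesis
      by (intro that(2)[of "x - 1" 1]) (auto simp: logit_event_def)
  qed
next
  case Reverse_logit
  with x have u: "logit_event n l x 0 \<union> logit_event n l x 1 = {1..x+1}"
    by (auto simp: logit_event_def)
  show ?thesis
  proof (cases "x + 1 = n")
    case True
    with u show ?thesis by (intro that(1)) simp
  next
    case False
    with x u Reverse_logit show ?thesis
      by (intro that(2)[of "x + 1" 0]) (auto simp: logit_event_def)
  qed
qed

lemma joint_prob_merge_rows:
  "joint_prob I1 I2 l1 l2 \<pi> i j 0 v + joint_prob I1 I2 l1 l2 \<pi> i j 1 v =
    measure_pmf.prob \<pi> ((logit_event I1 l1 i 0 \<union> logit_event I1 l1 i 1) \<times> logit_event I2 l2 j v)"
  unfolding joint_prob_def Sigma_Un_distrib1 using logit_event_disjoint[of I1 l1 i]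
  by (intro measure_pmf.finite_measure_Union[symmetric]) auto

lemma joint_prob_merge_cols:
  "joint_prob I1 I2 l1 l2 \<pi> i j u 0 + joint_prob I1 I2 l1 l2 \<pi> i j u 1 =
    measure_pmf.prob \<pi> (logit_event I1 l1 i u \<times> (logit_event I2 l2 j 0 \<union> logit_event I2 l2 j 1))"
  unfolding joint_prob_def Sigma_Un_distrib2 using logit_event_disjoint[of I2 l2 j]
  by (intro measure_pmf.finite_measure_Union[symmetric]) auto

text \<open>Both events differ only by a null set. This turns a merged event that covers all
  categories into a prescribed marginal.\<close>

lemma prob_certain_times:
  assumes "fst ` set_pmf \<pi> \<subseteq> A"
  shows "measure_pmf.prob \<pi> (A \<times> B) = measure_pmf.prob (map_pmf snd \<pi>) B"
proof -
  have "measure_pmf.prob \<pi> (A \<times> B) = measure_pmf.prob \<pi> (snd -` B)"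
    using assms by (intro measure_prob_cong_0) (auto simp: pmf_eq_0_set_pmf image_subset_iff)
  then show ?thesis by simp
qed

lemma prob_times_certain:
  assumes "snd ` set_pmf \<pi> \<subseteq> B"
  shows "measure_pmf.prob \<pi> (A \<times> B) = measure_pmf.prob (map_pmf fst \<pi>) A"
proof -
  have "measure_pmf.prob \<pi> (A \<times> B) = measure_pmf.prob \<pi> (fst -` A)"
    using assms by (intro measure_prob_cong_0) (auto simp: pmf_eq_0_set_pmf image_subset_iff)
  then show ?thesis by simp
qed

theorem proposition2:
  fixes \<phi> :: "real \<Rightarrow> real"
    and I1 I2 K :: nat
    and l1 l2 :: logit
    and \<pi> \<pi>' :: "(nat \<times> nat) pmf"
    and \<alpha> \<beta> \<alpha>' \<beta>' :: "nat \<Rightarrow> nat \<Rightarrow> nat \<Rightarrow> real"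
    and \<psi> \<psi>' :: "nat \<Rightarrow> real"
    and \<mu> \<nu> \<mu>' \<nu>' :: "nat \<Rightarrow> nat \<Rightarrow> real"
  assumes "convex_on {0..} \<phi>"
    and "\<And>x. x > 0 \<Longrightarrow> \<phi> differentiable (at x)"
    and "\<phi> 1 = 0" and "deriv \<phi> 1 = 0"
    and "strict_mono_on {0<..} (deriv \<phi>)"
    and "I1 \<ge> 2" and "I2 \<ge> 2"
    and "l1 \<in> {Global_logit, Continuation_logit, Reverse_logit}"
    and "l2 \<in> {Global_logit, Continuation_logit, Reverse_logit}"
    and "set_pmf \<pi> = {1..I1} \<times> {1..I2}"
    and "set_pmf \<pi>' = {1..I1} \<times> {1..I2}"
    and "association_model \<phi> I1 I2 l1 l2 \<pi> K \<alpha> \<beta> \<psi> \<mu> \<nu>"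
    and "association_model \<phi> I1 I2 l1 l2 \<pi>' K \<alpha>' \<beta>' \<psi>' \<mu>' \<nu>'"
    and "\<forall>i\<in>{1..I1-1}. \<forall>u\<in>{0,1}. row_prob I1 l1 \<pi> i u = row_prob I1 l1 \<pi>' i u"
    and "\<forall>j\<in>{1..I2-1}. \<forall>v\<in>{0,1}. col_prob I2 l2 \<pi> j v = col_prob I2 l2 \<pi>' j v"
    and "\<forall>i\<in>{1..I1-1}. \<forall>j\<in>{1..I2-1}.
           interaction K \<psi> \<mu> \<nu> i j = interaction K \<psi>' \<mu>' \<nu>' i j"
  shows "\<forall>i\<in>{1..I1-1}. \<forall>j\<in>{1..I2-1}. \<forall>u\<in>{0,1}. \<forall>v\<in>{0,1}.
           joint_prob I1 I2 l1 l2 \<pi> i j u v = joint_prob I1 I2 l1 l2 \<pi>' i j u v"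
proof -
  let ?p = "joint_prob I1 I2 l1 l2 \<pi>" and ?p' = "joint_prob I1 I2 l1 l2 \<pi>'"
  have supp: "fst ` set_pmf \<pi> \<subseteq> {1..I1}" "fst ` set_pmf \<pi>' \<subseteq> {1..I1}"
    "snd ` set_pmf \<pi> \<subseteq> {1..I2}" "snd ` set_pmf \<pi>' \<subseteq> {1..I2}"
    using assms(10,11) by auto
  have "\<forall>u\<in>{0,1}. \<forall>v\<in>{0,1}. ?p i j u v = ?p' i j u v"
    if "i \<in> {1..I1-1}" "j \<in> {1..I2-1}" for i j
    using that
  \<comment> \<open>Merging row events changes only \<open>i\<close> and merging column events only
    \<open>j\<close>; in the sum of the depths, either is a descent.\<close>
  proof (induction "cut_depth I1 l1 i + cut_depth I2 l2 j" arbitrary: i j rule: less_induct)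
    case less
    note i = less.prems(1) and j = less.prems(2)
    \<comment> \<open>Column totals come from merging the two row events, so the case split concerns
      \<open>l1\<close> while the prescribed margin is that of the columns.\<close>
    have cols: "?p i j 0 v + ?p i j 1 v = ?p' i j 0 v + ?p' i j 1 v" if v: "v \<in> {0,1}" for v
      using assms(8) i
    proof (cases rule: logit_event_merge)
      case 1
      then show ?thesis
        unfolding joint_prob_merge_rows 1
        using assms(15) j v by (simp only: prob_certain_times supp flip: col_prob_def)
    next
      case (2 y w)
      have "?p y j w v = ?p' y j w v"
        using less.hyps[OF add_strict_right_mono[OF 2(4)] 2(1) j] 2(2) v by blast
      then show ?thesis
        unfolding joint_prob_merge_rows 2(3) by (simp only: joint_prob_def)
    qed
    have rows: "?p i j u 0 + ?p i j u 1 = ?p' i j u 0 + ?p' i j u 1" if u: "u \<in> {0,1}" for u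
      using assms(9) j
    proof (cases rule: logit_event_merge)
      case 1
      then show ?thesis
        unfolding joint_prob_merge_cols 1
        using assms(14) i u by (simp only: prob_times_certain supp flip: row_prob_def)
    next
      case (2 y w)
      have "?p i y u w = ?p' i y u w"
        using less.hyps[OF add_strict_left_mono[OF 2(4)] i 2(1)] 2(2) u by blast
      then show ?thesis
        unfolding joint_prob_merge_cols 2(3) by (simp only: joint_prob_def)
    qed
    let ?x = "\<lambda>u v. \<alpha> i j u + \<beta> i j v + upsilon K \<psi> \<mu> \<nu> i j u v"
    let ?x' = "\<lambda>u v. \<alpha>' i j u + \<beta>' i j v + upsilon K \<psi>' \<mu>' \<nu>' i j u v"
    let ?r = "row_prob I1 l1 \<pi> i" and ?c = "col_prob I2 l2 \<pi> j"
    have nonneg: "?r u \<ge> 0" "?c v \<ge> 0" for u v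
      by (simp_all add: row_prob_def col_prob_def)
    have x: "?x u v \<in> deriv \<phi> ` {0<..} \<and>
        ?p i j u v = ?r u * ?c v * inv_into {0<..} (deriv \<phi>) (?x u v)"
      if "u \<in> {0,1}" "v \<in> {0,1}" for u v
      using assms(12) i j that unfolding association_model_def deriv_inverse_def by blast
    \<comment> \<open>The margins of \<pi>' are replaced by those of \<pi>, so that both tables
      share the factors \<open>?r\<close> and \<open>?c\<close>.\<close>
    have x': "?x' u v \<in> deriv \<phi> ` {0<..} \<and>
        ?p' i j u v = ?r u * ?c v * inv_into {0<..} (deriv \<phi>) (?x' u v)"
      if "u \<in> {0,1}" "v \<in> {0,1}" for u v
    proof -
      have "row_prob I1 l1 \<pi>' i u = ?r u" "col_prob I2 l2 \<pi>' j v = ?c v"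
        using assms(14,15) i j that by metis+
      then show ?thesis
        using assms(13) i j that unfolding association_model_def deriv_inverse_def by metis
    qed
    \<comment> \<open>The \<alpha> terms do not depend on \<open>v\<close> and the \<beta> terms not
      on \<open>u\<close>, so both cancel in the alternating sum.\<close>
    have inter: "?x 0 0 - ?x 0 1 - ?x 1 0 + ?x 1 1 = ?x' 0 0 - ?x' 0 1 - ?x' 1 0 + ?x' 1 1"
    proof -
      have "interaction K \<psi> \<mu> \<nu> i j = interaction K \<psi>' \<mu>' \<nu>' i j"
        using assms(16) i j by blast
      then show ?thesis
        unfolding interaction_def by linarith
    qed
    show ?case
      using table_unique[OF assms(5) nonneg x x' rows cols inter] by blast
  qed
  then show ?thesis
    by blast
qed

end
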